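(* For every integer $k \ge 4$ and all integers $p \ge k+2$ and $q \ge k+1$, $$r_k(p,q) \ge d\cdot\bigl(r_k(p-1,q)-1\bigr)+1, \qquad\text{where } d = \left\lfloor \frac{q-1}{k-2} \right\rfloor.$$
   Context: For integers $k,p,q$, the Ramsey number $r_k(p,q)$ is the smallest integer $N$ such that for every coloring of all $k$-element subsets of $\{1,\dots,N\}$ with the colors red and blue, there exist either $p$ elements of $\{1,\dots,N\}$ all of whose $k$-element subsets are red, or $q$ elements of $\{1,\dots,N\}$ all of whose $k$-element subsets are blue. *)

theory Defs
  imports Main "HOL-Library.Ramsey"
begin

text \<open>
  \<^term>\<open>partn_lst \<beta> [p, q] k\<close> says that every colouring of the \<^term>\<open>k\<close>-element subsets of
  \<^term>\<open>\<beta>\<close> with the colours 0 (red) and 1 (blue) has a \<^term>\<open>p\<close>-element subset of \<^term>\<open>\<beta>\<close> all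
  of whose \<^term>\<open>k\<close>-element subsets are red or a \<^term>\<open>q\<close>-element subset all of whose
  \<^term>\<open>k\<close>-element subsets are blue; see \<open>partn_lst_two_colours\<close> below.
\<close>

definition ramsey_number :: "nat \<Rightarrow> nat \<Rightarrow> nat \<Rightarrow> nat" where
  "ramsey_number k p q = (LEAST N. partn_lst {1..N} [p, q] k)"

lemma partn_lst_two_colours:
  "partn_lst \<beta> [p, q] k \<longleftrightarrow>
    (\<forall>f \<in> [\<beta>]\<^bsup>k\<^esup> \<rightarrow> {0, 1 :: nat}.
      (\<exists>H \<in> [\<beta>]\<^bsup>p\<^esup>. \<forall>X \<in> [H]\<^bsup>k\<^esup>. f X = 0) \<or>
      (\<exists>H \<in> [\<beta>]\<^bsup>q\<^esup>. \<forall>X \<in> [H]\<^bsup>k\<^esup>. f X = 1))"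
proof -
  have "{..<length [p, q]} = {0, 1}"
    by auto
  moreover have "(\<exists>i < length [p, q]. P i) \<longleftrightarrow> P 0 \<or> P 1" for P
    by (auto simp: less_Suc_eq)
  ultimately show ?thesis
    unfolding partn_lst_def monochromatic_def by (simp add: image_subset_iff)
qed

text \<open>The set over which the minimum is taken is never empty, by Ramsey's theorem.\<close>

lemma partn_lst_ramsey_number: "partn_lst {1..ramsey_number k p q} [p, q] k"
proof -
  obtain M :: nat where M: "partn_lst {..<M} [p, q] k"
    using ramsey_full by blast
  have sub: "bij_betw Suc {..<M} {1..M}"
    by (simp add: bij_betw_def image_Suc_lessThan)
  have "partn_lst {1..M} [p, q] k"
    unfolding partn_lst_def
  proof
    fix f :: "nat set \<Rightarrow> nat"
    assume f: "f \<in> [{1..M}]\<^bsup>k\<^esup> \<rightarrow> {..<length [p, q]}"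
    have "f \<circ> (\<lambda>X. Suc ` X) \<in> [{..<M}]\<^bsup>k\<^esup> \<rightarrow> {..<length [p, q]}"
      using f by (rule nsets_compose_image_funcset) auto
    then obtain i H where i: "i < length [p, q]" and H: "H \<in> [{..<M}]\<^bsup>([p, q] ! i)\<^esup>"
      and mono: "(f \<circ> (\<lambda>X. Suc ` X)) ` [H]\<^bsup>k\<^esup> \<subseteq> {i}"
      using M partn_lstE by blast
    have "Suc ` H \<in> [{1..M}]\<^bsup>([p, q] ! i)\<^esup>"
      using bij_betw_nsets[OF sub] H by (meson bij_betwE)
    moreover have "f ` [Suc ` H]\<^bsup>k\<^esup> \<subseteq> {i}"
    proof clarify
      fix X assume "X \<in> [Suc ` H]\<^bsup>k\<^esup>"
      then obtain Y where "Y \<in> [H]\<^bsup>k\<^esup>" "X = Suc ` Y"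
        by (rule nset_image_obtains) auto
      then show "f X = i"
        using mono by auto
    qed
    ultimately show "\<exists>i<length [p, q]. monochromatic {1..M} ([p, q] ! i) k f i"
      using i unfolding monochromatic_def by blast
  qed
  then show ?thesis
    unfolding ramsey_number_def by (rule LeastI)
qed

text \<open>
  Hence the truncated subtraction \<^term>\<open>ramsey_number k p q - 1\<close> is the true one for positive
  arguments.
\<close>

lemma ramsey_number_pos:
  assumes "p > 0" "q > 0"
  shows "ramsey_number k p q > 0"
proof (rule ccontr)
  assume "\<not> ramsey_number k p q > 0"
  then have "partn_lst ({} :: nat set) [p, q] k"
    using partn_lst_ramsey_number[of k p q] by simp
  then show False
    using assms by (auto simp: partn_lst_two_colours nsets_empty_iff)
qed

end

theory Submission
  imports Defs
begin

text \<open>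
  A colouring of an \<open>n\<close>-element set without a red \<open>(p - 1)\<close>-set and without a blue \<open>q\<close>-set is
  copied onto \<open>d = (q - 1) div (k - 2)\<close> disjoint blocks of \<open>n\<close> points each. A \<open>k\<close>-set that lies in one block keeps its
  colour; any other \<open>k\<close>-set is red if it has exactly \<open>k - 1\<close> points in some block, and blue
  otherwise.

  A blue \<open>q\<close>-set cannot lie in one block, and it has at most \<open>k - 2\<close> points in each block,
  since \<open>k - 1\<close> points of one block and a further point elsewhere form a red set; so
  \<open>q \<le> d * (k - 2) \<le> q - 1\<close>, which is absurd. A red \<open>p\<close>-set has at most \<open>p - 2\<close> points in each
  block, hence at least two points outside each block. If some block contains at least \<open>k - 2\<close>
  of its points, then \<open>k - 2\<close> of them together with two points outside form a blue set, because
  \<open>2 < k - 1\<close>. If there is no such block, all its \<open>k\<close>-subsets are blue.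
\<close>

text \<open>
  The colouring that a colouring \<open>g\<close> of \<open>k\<close>-sets (0 is red, 1 is blue) induces on a disjoint union
  of copies of its ground set. The point \<open>x\<close> is the copy of \<open>pos x\<close> in the block \<open>blk x\<close>; only the
  pairs \<open>(blk x, pos x)\<close> need to be distinct, so blocks may lack some points.
\<close>

definition block_colouring ::
  "nat \<Rightarrow> ('a \<Rightarrow> 'i) \<Rightarrow> ('a \<Rightarrow> 'b) \<Rightarrow> ('b set \<Rightarrow> nat) \<Rightarrow> 'a set \<Rightarrow> nat" where
  "block_colouring k blk pos g X =
    (if \<exists>b. blk ` X \<subseteq> {b} then g (pos ` X)
     else if \<exists>b. card {x \<in> X. blk x = b} = k - 1 then 0 else 1)"

lemma block_colouring_in_block:
  assumes "blk ` X \<subseteq> {b}"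
  shows "block_colouring k blk pos g X = g (pos ` X)"
  unfolding block_colouring_def using assms by meson

lemma inj_on_pos_in_block:
  assumes "inj_on (\<lambda>x. (blk x, pos x)) V" "X \<subseteq> V" "blk ` X \<subseteq> {b}"
  shows "inj_on pos X"
proof (rule inj_onI)
  fix x y assume "x \<in> X" "y \<in> X" "pos x = pos y"
  moreover from this have "blk x = blk y"
    using assms(3) by (metis imageI singletonD subsetD)
  ultimately show "x = y"
    using assms(1,2) by (auto dest: inj_onD)
qed

lemma block_colouring_funcset:
  assumes g: "g \<in> [A]\<^bsup>k\<^esup> \<rightarrow> {0, 1}"
    and pos: "pos \<in> V \<rightarrow> A" and inj: "inj_on (\<lambda>x. (blk x, pos x)) V"
  shows "block_colouring k blk pos g \<in> [V]\<^bsup>k\<^esup> \<rightarrow> {0, 1}"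
proof
  fix X assume X: "X \<in> [V]\<^bsup>k\<^esup>"
  have "g (pos ` X) \<in> {0, 1}" if b: "blk ` X \<subseteq> {b}" for b
  proof -
    have "inj_on pos X"
      using inj_on_pos_in_block[OF inj _ b] X by (simp add: nsets_def)
    then have "pos ` X \<in> [A]\<^bsup>k\<^esup>"
      using X pos by (auto simp: nsets_def card_image)
    then show ?thesis
      using g by auto
  qed
  then show "block_colouring k blk pos g X \<in> {0, 1}"
    unfolding block_colouring_def by (split if_split, split if_split) blast
qed

lemma monochromatic_in_block:
  assumes pos: "pos \<in> V \<rightarrow> A" and inj: "inj_on (\<lambda>x. (blk x, pos x)) V"
    and H: "H \<in> [V]\<^bsup>m\<^esup>" and b: "blk ` H \<subseteq> {b}"
    and mono: "\<forall>X \<in> [H]\<^bsup>k\<^esup>. block_colouring k blk pos g X = c"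
  shows "\<exists>H' \<in> [A]\<^bsup>m\<^esup>. \<forall>X \<in> [H']\<^bsup>k\<^esup>. g X = c"
proof
  have inj': "inj_on pos H"
    using inj_on_pos_in_block[OF inj _ b] H by (simp add: nsets_def)
  then show "pos ` H \<in> [A]\<^bsup>m\<^esup>"
    using H pos by (auto simp: nsets_def card_image)
  show "\<forall>X \<in> [pos ` H]\<^bsup>k\<^esup>. g X = c"
  proof
    fix X assume "X \<in> [pos ` H]\<^bsup>k\<^esup>"
    then obtain Y where Y: "Y \<in> [H]\<^bsup>k\<^esup>" "X = pos ` Y"
      by (rule nset_image_obtains) (use inj' in auto)
    moreover from this have "blk ` Y \<subseteq> {b}"
      using b by (auto simp: nsets_def)
    ultimately show "g X = c"
      using mono block_colouring_in_block by metis
  qed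
qed

text \<open>
  The construction in general form: at most \<open>card I\<close> blocks, each a copy of a subset of \<open>A\<close>.
\<close>

lemma not_partn_lst_blocks:
  fixes k p q :: nat and blk :: "'a \<Rightarrow> 'i" and pos :: "'a \<Rightarrow> 'b"
  assumes k: "k \<ge> 4" and p: "p \<ge> k"
    and A: "\<not> partn_lst A [p - 1, q] k"
    and I: "finite I" "card I * (k - 2) < q"
    and blk: "blk \<in> V \<rightarrow> I" and pos: "pos \<in> V \<rightarrow> A"
    and inj: "inj_on (\<lambda>x. (blk x, pos x)) V"
  shows "\<not> partn_lst V [p, q] k"
proof
  assume V: "partn_lst V [p, q] k"
  from A obtain g where g: "g \<in> [A]\<^bsup>k\<^esup> \<rightarrow> {0, 1 :: nat}"
    and no_red: "\<not> (\<exists>H \<in> [A]\<^bsup>(p - 1)\<^esup>. \<forall>X \<in> [H]\<^bsup>k\<^esup>. g X = 0)"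
    and no_blue: "\<not> (\<exists>H \<in> [A]\<^bsup>q\<^esup>. \<forall>X \<in> [H]\<^bsup>k\<^esup>. g X = 1)"
    unfolding partn_lst_two_colours by blast
  let ?f = "block_colouring k blk pos g"
  have "?f \<in> [V]\<^bsup>k\<^esup> \<rightarrow> {0, 1}"
    using g pos inj by (rule block_colouring_funcset)
  then consider
      (red) H where "H \<in> [V]\<^bsup>p\<^esup>" "\<forall>X \<in> [H]\<^bsup>k\<^esup>. ?f X = 0"
    | (blue) H where "H \<in> [V]\<^bsup>q\<^esup>" "\<forall>X \<in> [H]\<^bsup>k\<^esup>. ?f X = 1"
    using V unfolding partn_lst_two_colours by blast
  then show False
  proof cases
    case blue
    then have H: "H \<subseteq> V" "finite H" "card H = q"
      by (auto simp: nsets_def)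
    have small: "card {x \<in> H. blk x = b} \<le> k - 2" for b
    proof (rule ccontr)
      assume "\<not> ?thesis"
      then have "k - 1 \<le> card {x \<in> H. blk x = b}"
        using k by linarith
      then obtain T where T: "T \<subseteq> {x \<in> H. blk x = b}" "card T = k - 1" "finite T"
        by (rule obtain_subset_with_card_n)
      have "\<not> blk ` H \<subseteq> {b}"
        using monochromatic_in_block[OF pos inj blue(1) _ blue(2)] no_blue by blast
      then obtain y where y: "y \<in> H" "blk y \<noteq> b"
        by auto
      then have "y \<notin> T"
        using T by auto
      let ?X = "insert y T"
      have X: "?X \<in> [H]\<^bsup>k\<^esup>"
        using T y \<open>y \<notin> T\<close> k by (auto simp: nsets_def)
      have "T \<noteq> {}"
        using T(2) k by auto
      then obtain t where "t \<in> T" "blk t = b"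
        using T(1) by auto
      then have "\<nexists>c. blk ` ?X \<subseteq> {c}"
        using y by auto
      moreover have "{x \<in> ?X. blk x = b} = T"
        using T y by auto
      ultimately have "?f ?X = 0"
        using T(2) unfolding block_colouring_def by metis
      then show False
        using blue(2) X by auto
    qed
    have "(\<Union>b\<in>I. {x \<in> H. blk x = b}) = H"
      using H blk by auto
    then have "card H \<le> (\<Sum>b\<in>I. card {x \<in> H. blk x = b})"
      using card_UN_le[OF I(1), of "\<lambda>b. {x \<in> H. blk x = b}"] by simp
    also have "\<dots> \<le> card I * (k - 2)"
      using sum_bounded_above[of I "\<lambda>b. card {x \<in> H. blk x = b}" "k - 2"] small by simp
    finally show False
      using H I by simp
  next
    case red
    then have H: "H \<subseteq> V" "finite H" "card H = p"
      by (auto simp: nsets_def)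
    have outside: "2 \<le> card {x \<in> H. blk x \<noteq> b}" for b
    proof (rule ccontr)
      assume less: "\<not> ?thesis"
      have "{x \<in> H. blk x = b} \<union> {x \<in> H. blk x \<noteq> b} = H"
        by auto
      then have "card H \<le> card {x \<in> H. blk x = b} + card {x \<in> H. blk x \<noteq> b}"
        using card_Un_le[of "{x \<in> H. blk x = b}" "{x \<in> H. blk x \<noteq> b}"] by simp
      then have "p - 1 \<le> card {x \<in> H. blk x = b}"
        using less H by linarith
      then obtain T where T: "T \<subseteq> {x \<in> H. blk x = b}" "card T = p - 1" "finite T"
        by (rule obtain_subset_with_card_n)
      have "T \<in> [V]\<^bsup>(p - 1)\<^esup>" "blk ` T \<subseteq> {b}"
        using T H by (auto simp: nsets_def)
      moreover have "\<forall>X \<in> [T]\<^bsup>k\<^esup>. ?f X = 0"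
        using red(2) T by (auto simp: nsets_def)
      ultimately have "\<exists>H' \<in> [A]\<^bsup>(p - 1)\<^esup>. \<forall>X \<in> [H']\<^bsup>k\<^esup>. g X = 0"
        by (rule monochromatic_in_block[OF pos inj])
      then show False
        using no_red by contradiction
    qed
    have blue_if: "?f X = 1" if X: "card X = k" "\<And>b. card {x \<in> X. blk x = b} \<le> k - 2" for X
    proof -
      have "\<not> blk ` X \<subseteq> {b}" for b
      proof
        assume "blk ` X \<subseteq> {b}"
        then have "{x \<in> X. blk x = b} = X"
          by auto
        then show False
          using X(1) X(2)[of b] k by simp
      qed
      moreover have "card {x \<in> X. blk x = b} \<noteq> k - 1" for b
        using X(2)[of b] k by linarith
      ultimately show ?thesis
        unfolding block_colouring_def by metis
    qed
    have "\<exists>X. X \<in> [H]\<^bsup>k\<^esup> \<and> (\<forall>b. card {x \<in> X. blk x = b} \<le> k - 2)"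
    proof (cases "\<exists>b. k - 2 \<le> card {x \<in> H. blk x = b}")
      case True
      then obtain b where "k - 2 \<le> card {x \<in> H. blk x = b}" ..
      then obtain T where T: "T \<subseteq> {x \<in> H. blk x = b}" "card T = k - 2" "finite T"
        by (rule obtain_subset_with_card_n)
      \<comment> \<open>The two points of \<open>U\<close> may share a block; \<open>2 \<le> k - 2\<close> since \<open>k \<ge> 4\<close>.\<close>
      obtain U where U: "U \<subseteq> {x \<in> H. blk x \<noteq> b}" "card U = 2" "finite U"
        using outside[of b] by (rule obtain_subset_with_card_n)
      have "T \<inter> U = {}"
        using T U by auto
      then have "T \<union> U \<in> [H]\<^bsup>k\<^esup>"
        using T U k by (auto simp: nsets_def card_Un_disjoint)
      moreover have "card {x \<in> T \<union> U. blk x = c} \<le> k - 2" for c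
      proof (cases "c = b")
        case True
        then have "{x \<in> T \<union> U. blk x = c} \<subseteq> T"
          using U by auto
        then show ?thesis
          using T card_mono by metis
      next
        case False
        then have "{x \<in> T \<union> U. blk x = c} \<subseteq> U"
          using T by auto
        then have "card {x \<in> T \<union> U. blk x = c} \<le> 2"
          using U card_mono by metis
        then show ?thesis
          using k by linarith
      qed
      ultimately show ?thesis
        by blast
    next
      case False
      have "k \<le> card H"
        using p H by simp
      then obtain X where X: "X \<subseteq> H" "card X = k" "finite X"
        by (rule obtain_subset_with_card_n)
      have "card {x \<in> X. blk x = b} \<le> k - 2" for b
      proof -
        have "card {x \<in> X. blk x = b} \<le> card {x \<in> H. blk x = b}"
          using X H by (intro card_mono) auto
        also have "\<dots> \<le> k - 2"
          using False by (meson nle_le)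
        finally show ?thesis .
      qed
      then show ?thesis
        using X by (auto simp: nsets_def)
    qed
    then obtain X where X: "X \<in> [H]\<^bsup>k\<^esup>" "\<And>b. card {x \<in> X. blk x = b} \<le> k - 2"
      by blast
    then have "?f X = 1"
      by (intro blue_if) (auto simp: nsets_def)
    then show False
      using red(2) X(1) by simp
  qed
qed

theorem theorem5:
  fixes k p q :: nat
  assumes "k \<ge> 4" and "p \<ge> k + 2" and "q \<ge> k + 1"
  shows "ramsey_number k p q \<ge> ((q - 1) div (k - 2)) * (ramsey_number k (p - 1) q - 1) + 1"
proof (rule ccontr)
  define d n where "d = (q - 1) div (k - 2)" and "n = ramsey_number k (p - 1) q - 1"
  assume "\<not> ?thesis"
  then have le: "ramsey_number k p q \<le> d * n"
    by (simp add: d_def n_def)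
  have "n < ramsey_number k (p - 1) q"
    using ramsey_number_pos[of "p - 1" q k] assms by (simp add: n_def)
  then have n: "\<not> partn_lst {1..n} [p - 1, q] k"
    unfolding ramsey_number_def by (rule not_less_Least)
  let ?V = "{1..ramsey_number k p q}"
  \<comment> \<open>The blocks are the \<open>d\<close> intervals of length \<open>n\<close> that make up \<open>{1..d * n}\<close>, cut off at the
      end of \<open>?V\<close>.\<close>
  let ?blk = "\<lambda>x. (x - 1) div n" and ?pos = "\<lambda>x. (x - 1) mod n + 1"
  have "card {..<d} * (k - 2) \<le> q - 1"
    by (simp add: d_def)
  then have d: "card {..<d} * (k - 2) < q"
    using assms by linarith
  have blk: "?blk \<in> ?V \<rightarrow> {..<d}"
    using le by (auto intro!: less_mult_imp_div_less)
  have pos: "?pos \<in> ?V \<rightarrow> {1..n}"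
  proof
    fix x assume "x \<in> ?V"
    then have "n > 0"
      using le by (cases n) auto
    then show "?pos x \<in> {1..n}"
      by (simp add: Suc_leI)
  qed
  have inj: "inj_on (\<lambda>x. (?blk x, ?pos x)) ?V"
  proof (rule inj_onI)
    fix x y assume xy: "x \<in> ?V" "y \<in> ?V" and "(?blk x, ?pos x) = (?blk y, ?pos y)"
    then have "x - 1 = y - 1"
      by (metis Pair_inject add_right_cancel div_mult_mod_eq)
    then show "x = y"
      using xy by auto
  qed
  have "\<not> partn_lst ?V [p, q] k"
    by (rule not_partn_lst_blocks[OF _ _ n _ d blk pos inj]) (use assms in auto)
  then show False
    using partn_lst_ramsey_number by blast
qed

end
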